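(* Let $F$ be a fractal of unity generated by the planar IFS $\mathcal{T}=\{T_1,\dots,T_n\}$. Then $F$ has a finite number of extremal points; specifically $|\mathrm{Ext}(F)|\le n^{2|\nu(\mathcal{A}_{fin})|}$.
   Context: IFS: $T_k(z)=p_k+\varphi_k(z-p_k)$ on $\mathbb{C}$, $k\in\mathcal{N}=\{1,\dots,n\}$, with $p_k\in\mathbb{C}$, $\varphi_k=\lambda_k e^{\vartheta_k i}$, $\lambda_k\in(0,1)$, rotation angle $\vartheta_k\in(-\pi,\pi]$. The IFS fractal $F$ is the unique nonempty compact set with $F=\bigcup_{k}T_k(F)$. It is a fractal of unity if $\vartheta_k/(2\pi)\in\mathbb{Q}$ for all $k$. $\mathcal{A}_{fin}$ is the set of finite words (addresses) over $\mathcal{N}$, including the empty word $0$. The value of a finite address $a$ of length $|a|$ is $\nu(a)=\vartheta_{a(1)}+\dots+\vartheta_{a(|a|)} \bmod 2\pi\in[0,2\pi)$, $\nu(0)=0$, and $\nu(\mathcal{A}_{fin})=\{\nu(a):a\in\mathcal{A}_{fin}\}$, a finite set for a fractal of unity. $\mathrm{Ext}(F)$ is the set of extremal points of $F$, i.e. extreme points (vertices) of the convex hull of $F$. *)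

theory Defs
  imports "HOL-Analysis.Analysis" "HOL-Library.Real_Mod"
begin

text \<open>
  The maps of the system are indexed by \<open>k \<in> {1..n}\<close>; the values of the parameters
  \<open>p\<close>, \<open>lam\<close>, \<open>theta\<close> outside this range are irrelevant.
\<close>

definition planar_ifs :: "nat \<Rightarrow> (nat \<Rightarrow> real) \<Rightarrow> (nat \<Rightarrow> real) \<Rightarrow> bool" where
  "planar_ifs n lam theta \<longleftrightarrow>
     n \<ge> 1 \<and> (\<forall>k\<in>{1..n}. lam k \<in> {0<..<1} \<and> theta k \<in> {-pi<..pi})"

definition ifs_factor :: "(nat \<Rightarrow> real) \<Rightarrow> (nat \<Rightarrow> real) \<Rightarrow> nat \<Rightarrow> complex" where
  "ifs_factor lam theta k = complex_of_real (lam k) * exp (complex_of_real (theta k) * \<i>)"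

definition ifs_map ::
    "(nat \<Rightarrow> complex) \<Rightarrow> (nat \<Rightarrow> real) \<Rightarrow> (nat \<Rightarrow> real) \<Rightarrow> nat \<Rightarrow> complex \<Rightarrow> complex" where
  "ifs_map p lam theta k z = p k + ifs_factor lam theta k * (z - p k)"

text \<open>
  For a contractive system (\<open>planar_ifs\<close>) exactly one set satisfies this predicate,
  by Hutchinson's theorem.
\<close>

definition ifs_fractal ::
    "nat \<Rightarrow> (nat \<Rightarrow> complex) \<Rightarrow> (nat \<Rightarrow> real) \<Rightarrow> (nat \<Rightarrow> real) \<Rightarrow> complex set \<Rightarrow> bool" where
  "ifs_fractal n p lam theta F \<longleftrightarrow>
     F \<noteq> {} \<and> compact F \<and> F = (\<Union>k\<in>{1..n}. ifs_map p lam theta k ` F)"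

definition fractal_of_unity ::
    "nat \<Rightarrow> (nat \<Rightarrow> complex) \<Rightarrow> (nat \<Rightarrow> real) \<Rightarrow> (nat \<Rightarrow> real) \<Rightarrow> complex set \<Rightarrow> bool" where
  "fractal_of_unity n p lam theta F \<longleftrightarrow>
     ifs_fractal n p lam theta F \<and> (\<forall>k\<in>{1..n}. theta k / (2 * pi) \<in> \<rat>)"

definition finite_addresses :: "nat \<Rightarrow> nat list set" where
  "finite_addresses n = lists {1..n}"

definition address_value :: "(nat \<Rightarrow> real) \<Rightarrow> nat list \<Rightarrow> real" where
  "address_value theta a = (\<Sum>k\<leftarrow>a. theta k) rmod (2 * pi)"

definition Ext :: "complex set \<Rightarrow> complex set" where
  "Ext F = {e. e extreme_point_of (convex hull F)}"

end

theory Submission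
  imports Defs
begin

text \<open>
  An extreme point \<open>e\<close> of the convex hull of a planar set \<open>F\<close> is selected by a direction \<open>u\<close>
  together with a side: \<open>e\<close> maximises the component along \<open>u\<close>, and among the points doing so it
  is the one furthest to the chosen side. Unlike an exposing linear functional, such a
  lexicographic order exists for \<^emph>\<open>every\<close> extreme point, and it still determines its maximiser
  uniquely. Both properties together are what makes counting possible.

  Now let \<open>F\<close> be the fractal. The maximiser \<open>e\<close> lies in some piece \<open>T\<^sub>k F\<close>, say \<open>e = T\<^sub>k f\<close>. As
  \<open>T\<^sub>k\<close> scales and rotates by \<open>\<theta>\<^sub>k\<close>, the point \<open>f\<close> is the maximiser in the direction \<open>u\<close> rotated
  by \<open>-\<theta>\<^sub>k\<close>, with the same side (\<open>lex_maximiser_descends\<close>). Hence all directions reachable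
  from \<open>u\<close> are \<open>u * w\<close>, where \<open>w\<close> runs through \<open>W = {cis (-v) | v a value of an address}\<close>.
  For a fractal of unity \<open>W\<close> is finite.

  Choosing for each \<open>w \<in> W\<close> a piece \<open>\<kappa> w\<close> containing the maximiser \<open>x w\<close> in the direction
  \<open>u * w\<close> gives the closed system of equations
  \<open>x w = T\<^bsub>\<kappa> w\<^esub> (x (w * cis (-\<theta>\<^bsub>\<kappa> w\<^esub>)))\<close>, which no longer mentions \<open>u\<close> or the side. All maps
  are contractions and \<open>W\<close> is finite, so the system has at most one solution
  (\<open>selection_solution_unique\<close>). Therefore \<open>e = x 1\<close> depends on \<open>\<kappa> : W \<rightarrow> {1..n}\<close> alone, and
  there are at most \<open>n\<close> to the power \<open>card W\<close> extreme points, which is even better than the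
  claim.
\<close>

section \<open>Lexicographic maximisers\<close>

text \<open>
  The points that do not exceed \<open>0\<close> when real parts are compared first and ties are broken by the
  imaginary part times \<open>s\<close>; the sign of \<open>s\<close> is the side. Multiplying by \<open>cnj u\<close> below turns the
  direction \<open>u\<close> into that of the positive real axis.
\<close>

definition lex_nonpos :: "real \<Rightarrow> complex \<Rightarrow> bool" where
  "lex_nonpos s w \<longleftrightarrow> Re w < 0 \<or> (Re w = 0 \<and> s * Im w \<le> 0)"

definition lex_maximiser :: "complex set \<Rightarrow> complex \<Rightarrow> real \<Rightarrow> complex \<Rightarrow> bool" where
  "lex_maximiser F u s x \<longleftrightarrow> x \<in> F \<and> (\<forall>z\<in>F. lex_nonpos s (cnj u * (z - x)))"

lemma lex_nonpos_antisym:
  assumes "s \<noteq> 0" "lex_nonpos s w" "lex_nonpos s (- w)"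
  shows "w = 0"
  using assms by (auto simp: lex_nonpos_def complex_eq_iff)

lemma lex_nonpos_scale:
  assumes "r > 0"
  shows "lex_nonpos s (of_real r * w) \<longleftrightarrow> lex_nonpos s w"
proof -
  have "s * (r * Im w) \<le> 0 \<longleftrightarrow> s * Im w \<le> 0"
    using assms by (auto simp: mult_le_0_iff zero_le_mult_iff)
  then show ?thesis
    using assms by (simp add: lex_nonpos_def mult_less_0_iff)
qed

lemma lex_maximiser_unique:
  assumes "u \<noteq> 0" "s \<noteq> 0" "lex_maximiser F u s x" "lex_maximiser F u s y"
  shows "x = y"
proof -
  have "lex_nonpos s (cnj u * (y - x))" "lex_nonpos s (- (cnj u * (y - x)))"
    using assms unfolding lex_maximiser_def by (simp_all add: algebra_simps)
  with assms lex_nonpos_antisym have "cnj u * (y - x) = 0"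
    by blast
  with assms show ?thesis by simp
qed

lemma lex_maximiser_exists:
  assumes "compact F" "F \<noteq> {}"
  obtains x where "lex_maximiser F u s x"
proof -
  have cont: "continuous_on A (\<lambda>z. Re (cnj u * z))" "continuous_on A (\<lambda>z. s * Im (cnj u * z))" for A
    by (intro continuous_intros)+
  obtain a where a: "a \<in> F" "\<And>z. z \<in> F \<Longrightarrow> Re (cnj u * z) \<le> Re (cnj u * a)"
    using continuous_attains_sup[OF assms cont(1)] by blast
  let ?E = "F \<inter> {z. Re (cnj u * z) = Re (cnj u * a)}"
  have "closed {z. Re (cnj u * z) = Re (cnj u * a)}"
    by (intro closed_Collect_eq continuous_intros)
  then have "compact ?E"
    using assms(1) by (rule compact_Int_closed[rotated])
  moreover have "?E \<noteq> {}"
    using a by blast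
  ultimately have "\<exists>b\<in>?E. \<forall>z\<in>?E. s * Im (cnj u * z) \<le> s * Im (cnj u * b)"
    by (rule continuous_attains_sup[OF _ _ cont(2)])
  then obtain b where b: "b \<in> ?E"
      "\<And>z. z \<in> ?E \<Longrightarrow> s * Im (cnj u * z) \<le> s * Im (cnj u * b)"
    by blast
  have "lex_nonpos s (cnj u * (z - b))" if "z \<in> F" for z
  proof (cases "z \<in> ?E")
    case True
    with b show ?thesis
      by (simp add: lex_nonpos_def right_diff_distrib)
  next
    case False
    with a(2)[OF that] that b(1) show ?thesis
      by (simp add: lex_nonpos_def right_diff_distrib)
  qed
  with b(1) that show ?thesis
    by (auto simp: lex_maximiser_def)
qed

text \<open>
  A supporting line at \<open>e\<close> gives the direction. The points of the hull on this line cannot lie on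
  both sides of \<open>e\<close>, for otherwise \<open>e\<close> would be inside a segment of the hull; this gives the side.
\<close>

lemma extreme_point_is_lex_maximiser:
  assumes e: "e extreme_point_of (convex hull F)"
  obtains u s where "u \<noteq> 0" "s \<noteq> 0" "lex_maximiser F u s e"
proof -
  let ?C = "convex hull F"
  have eF: "e \<in> F"
    using e by (rule extreme_point_of_convex_hull)
  have sub: "F \<subseteq> ?C"
    by (rule hull_subset)
  obtain a where a: "a \<noteq> 0" "\<And>y. y \<in> ?C \<Longrightarrow> a \<bullet> e \<le> a \<bullet> y"
  proof (cases "?C = {e}")
    case True
    with that[of 1] show thesis by simp
  next
    case False
    with e have "e \<notin> rel_interior ?C"
      using extreme_point_not_in_REL_INTERIOR by blast
    moreover have "e \<in> ?C"
      using eF sub by blast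
    ultimately show thesis
      using supporting_hyperplane_rel_boundary[OF convex_convex_hull] that by blast
  qed
  have le0: "Re (cnj (- a) * (z - e)) \<le> 0" if "z \<in> F" for z
  proof -
    have "z \<in> ?C"
      using that sub by blast
    from a(2)[OF this] show ?thesis
      by (simp add: inner_complex_def algebra_simps)
  qed
  have one_side: "\<not> (Im (cnj (- a) * (y - e)) < 0 \<and> 0 < Im (cnj (- a) * (z - e)))"
    if yz: "y \<in> F" "z \<in> F" "Re (cnj (- a) * (y - e)) = 0" "Re (cnj (- a) * (z - e)) = 0" for y z
  proof
    let ?p = "Im (cnj (- a) * (y - e))" and ?q = "Im (cnj (- a) * (z - e))"
    assume neg: "?p < 0 \<and> 0 < ?q"
    \<comment> \<open>the weights that annihilate the position of \<open>e\<close> on the line through \<open>y\<close> and \<open>z\<close>\<close>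
    define t where "t = - ?p / (?q - ?p)"
    have t: "0 < t" "t < 1"
      using neg by (auto simp: t_def field_simps)
    have "(1 - t) * ?p + t * ?q = ?p + t * (?q - ?p)"
      by (simp only: algebra_simps)
    also have "\<dots> = 0"
      using neg by (simp add: t_def)
    finally have bal: "(1 - t) * ?p + t * ?q = 0" .
    have "cnj (- a) * ((1 - t) *\<^sub>R (y - e) + t *\<^sub>R (z - e))
        = (1 - t) *\<^sub>R (cnj (- a) * (y - e)) + t *\<^sub>R (cnj (- a) * (z - e))"
      by (simp only: distrib_left mult_scaleR_right)
    also have "\<dots> = 0"
      using yz bal by (simp only: complex_eq_iff plus_complex.sel scaleR_complex.sel
          zero_complex.sel mult_zero_right add_0_left simp_thms)
    finally have "(1 - t) *\<^sub>R (y - e) + t *\<^sub>R (z - e) = 0"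
      using a(1) by (simp only: mult_eq_0_iff) simp
    then have "e = (1 - t) *\<^sub>R y + t *\<^sub>R z"
      by (simp add: algebra_simps)
    moreover have "y \<noteq> z"
      using neg by auto
    ultimately have "e \<in> open_segment y z"
      using t by (auto simp: in_segment)
    moreover have "y \<in> ?C" "z \<in> ?C"
      using yz sub by blast+
    ultimately show False
      using e by (auto simp: extreme_point_of_def)
  qed
  show thesis
  proof (cases "\<exists>z\<in>F. Re (cnj (- a) * (z - e)) = 0 \<and> Im (cnj (- a) * (z - e)) > 0")
    case True
    then obtain z where z: "z \<in> F" "Re (cnj (- a) * (z - e)) = 0" "Im (cnj (- a) * (z - e)) > 0"
      by blast
    have "lex_nonpos (- 1) (cnj (- a) * (y - e))" if "y \<in> F" for y
      using le0[OF that] one_side[OF that z(1) _ z(2)] z(3)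
      unfolding lex_nonpos_def by linarith
    then have "lex_maximiser F (- a) (- 1) e"
      using eF by (simp only: lex_maximiser_def) blast
    with a(1) that[of "- a" "- 1"] show ?thesis by simp
  next
    case False
    have "lex_nonpos 1 (cnj (- a) * (y - e))" if "y \<in> F" for y
      using le0[OF that] False that
      unfolding lex_nonpos_def mult_1 by (meson linorder_not_less order_le_less)
    then have "lex_maximiser F (- a) 1 e"
      using eF by (simp only: lex_maximiser_def) blast
    with a(1) that[of "- a" 1] show ?thesis by simp
  qed
qed

section \<open>Maximisers of the fractal\<close>

lemma ifs_map_diff:
  "ifs_map p lam theta k x - ifs_map p lam theta k y = ifs_factor lam theta k * (x - y)"
  by (simp add: ifs_map_def algebra_simps)

lemma ifs_factor_cis: "ifs_factor lam theta k = of_real (lam k) * cis (theta k)"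
  by (simp add: ifs_factor_def cis_conv_exp mult.commute)

text \<open>
  Comparing \<open>T\<^sub>k f\<close> with the points of \<open>T\<^sub>k F \<subseteq> F\<close> in the direction \<open>u\<close> amounts to comparing \<open>f\<close>
  with the points of \<open>F\<close> in the direction \<open>u\<close> turned back by \<open>\<theta>\<^sub>k\<close>: the positive factor \<open>\<lambda>\<^sub>k\<close> does
  not change the order.
\<close>

lemma lex_maximiser_descends:
  assumes ifs: "planar_ifs n lam theta" and F: "ifs_fractal n p lam theta F"
    and x: "lex_maximiser F u s x"
  obtains k f where "k \<in> {1..n}" "x = ifs_map p lam theta k f"
    "lex_maximiser F (u * cis (- theta k)) s f"
proof -
  have Feq: "F = (\<Union>k\<in>{1..n}. ifs_map p lam theta k ` F)"
    using F by (simp add: ifs_fractal_def)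
  have "x \<in> (\<Union>k\<in>{1..n}. ifs_map p lam theta k ` F)"
    using x Feq by (auto simp: lex_maximiser_def)
  then obtain k f where k: "k \<in> {1..n}" and f: "f \<in> F" and xf: "x = ifs_map p lam theta k f"
    by blast
  have lam: "lam k > 0"
    using ifs k by (auto simp: planar_ifs_def)
  have "lex_nonpos s (cnj (u * cis (- theta k)) * (z - f))" if "z \<in> F" for z
  proof -
    have "ifs_map p lam theta k z \<in> F"
      using that k by (subst Feq) blast
    then have "lex_nonpos s (cnj u * (ifs_map p lam theta k z - x))"
      using x by (simp add: lex_maximiser_def)
    also have "cnj u * (ifs_map p lam theta k z - x)
        = of_real (lam k) * (cnj (u * cis (- theta k)) * (z - f))"
      by (simp add: xf ifs_map_diff ifs_factor_cis cis_cnj)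
    finally show ?thesis
      using lex_nonpos_scale[OF lam] by blast
  qed
  with k f xf that show ?thesis
    by (auto simp: lex_maximiser_def)
qed

section \<open>Counting selections of pieces\<close>

text \<open>
  The system of equations expressing that the point attached to the rotation \<open>w\<close> lies in the piece
  \<open>\<kappa> w\<close>.
\<close>

definition selection_solution ::
    "(nat \<Rightarrow> complex) \<Rightarrow> (nat \<Rightarrow> real) \<Rightarrow> (nat \<Rightarrow> real) \<Rightarrow> complex set \<Rightarrow> (complex \<Rightarrow> nat)
      \<Rightarrow> (complex \<Rightarrow> complex) \<Rightarrow> bool" where
  "selection_solution p lam theta W \<kappa> x \<longleftrightarrow>
     (\<forall>w\<in>W. x w = ifs_map p lam theta (\<kappa> w) (x (w * cis (- theta (\<kappa> w)))))"

text \<open>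
  At a rotation \<open>m\<close> where the distance of two solutions is largest, the equations bound this
  distance by \<open>\<lambda>\<close> times another such distance, so it vanishes.
\<close>

lemma selection_solution_unique:
  assumes ifs: "planar_ifs n lam theta"
    and W: "finite W" "\<And>w k. w \<in> W \<Longrightarrow> k \<in> {1..n} \<Longrightarrow> w * cis (- theta k) \<in> W"
    and \<kappa>: "\<kappa> \<in> W \<rightarrow> {1..n}"
    and x: "selection_solution p lam theta W \<kappa> x"
    and y: "selection_solution p lam theta W \<kappa> y"
    and w: "w \<in> W"
  shows "x w = y w"
proof -
  let ?d = "\<lambda>w. norm (x w - y w)"
  have "Max (?d ` W) \<in> ?d ` W"
    using W(1) w by (intro Max_in) auto
  then obtain m where "m \<in> W" and max: "Max (?d ` W) = ?d m"
    by blast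
  moreover have "?d v \<le> ?d m" if "v \<in> W" for v
    using that W(1) unfolding max[symmetric] by (intro Max_ge) auto
  ultimately have m: "m \<in> W" "\<And>v. v \<in> W \<Longrightarrow> ?d v \<le> ?d m"
    by blast+
  define k where "k = \<kappa> m"
  have k: "k \<in> {1..n}"
    using \<kappa> m by (auto simp: k_def)
  then have lam: "0 < lam k" "lam k < 1"
    using ifs by (auto simp: planar_ifs_def)
  let ?m' = "m * cis (- theta k)"
  have "x m = ifs_map p lam theta k (x ?m')" "y m = ifs_map p lam theta k (y ?m')"
    using x y m(1) unfolding selection_solution_def k_def by blast+
  then have "x m - y m = ifs_factor lam theta k * (x ?m' - y ?m')"
    by (simp only: ifs_map_diff)
  then have "?d m = lam k * ?d ?m'"
    using lam by (simp add: ifs_factor_cis norm_mult)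
  also have "\<dots> \<le> lam k * ?d m"
    using lam m W(2)[OF m(1) k] by (intro mult_left_mono) auto
  finally have "(1 - lam k) * ?d m \<le> 0"
    by (simp add: algebra_simps)
  with lam have "?d m \<le> 0"
    by (simp add: mult_le_0_iff)
  with m(2)[OF w] show ?thesis by simp
qed

text \<open>
  Any set \<open>W\<close> of rotations that contains \<open>1\<close> and is closed under turning back by the angles of the
  maps supports the counting: an extreme point is the component at \<open>1\<close> of a solution, and the
  solution is recovered from the selection of pieces.
\<close>

lemma card_Ext_le_card_selections:
  assumes ifs: "planar_ifs n lam theta" and F: "ifs_fractal n p lam theta F"
    and W: "finite W" "1 \<in> W" "0 \<notin> W"
      "\<And>w k. w \<in> W \<Longrightarrow> k \<in> {1..n} \<Longrightarrow> w * cis (- theta k) \<in> W"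
  shows "finite (Ext F)" "card (Ext F) \<le> n ^ card W"
proof -
  let ?K = "W \<rightarrow>\<^sub>E {1..n}"
  define g where "g = (\<lambda>\<kappa>. (SOME x. selection_solution p lam theta W \<kappa> x) 1)"
  have "Ext F \<subseteq> g ` ?K"
  proof
    fix e assume "e \<in> Ext F"
    then have "e extreme_point_of (convex hull F)"
      by (simp add: Ext_def)
    then obtain u s where us: "u \<noteq> 0" "s \<noteq> 0" "lex_maximiser F u s e"
      by (rule extreme_point_is_lex_maximiser)
    \<comment> \<open>fixing one maximiser per rotation makes the equations close up, by uniqueness\<close>
    have "\<exists>x. lex_maximiser F (u * w) s x" for w
      using F lex_maximiser_exists by (metis ifs_fractal_def)
    then obtain x where x: "\<And>w. lex_maximiser F (u * w) s (x w)"
      by metis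
    have "\<exists>k\<in>{1..n}. x w = ifs_map p lam theta k (x (w * cis (- theta k)))" if "w \<in> W" for w
    proof -
      obtain k f where kf: "k \<in> {1..n}" "x w = ifs_map p lam theta k f"
          "lex_maximiser F (u * w * cis (- theta k)) s f"
        using lex_maximiser_descends[OF ifs F x] by blast
      have "w * cis (- theta k) \<noteq> 0"
        using W that by (auto simp: cis_neq_zero)
      then have "f = x (w * cis (- theta k))"
        using us kf(3) x[of "w * cis (- theta k)"]
        by (intro lex_maximiser_unique[of "u * w * cis (- theta k)" s F]) (auto simp: mult.assoc)
      with kf show ?thesis by blast
    qed
    then obtain \<kappa>' where \<kappa>': "\<And>w. w \<in> W \<Longrightarrow> \<kappa>' w \<in> {1..n} \<and>
        x w = ifs_map p lam theta (\<kappa>' w) (x (w * cis (- theta (\<kappa>' w))))"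
      by metis
    define \<kappa> where "\<kappa> = restrict \<kappa>' W"
    have \<kappa>: "\<kappa> \<in> ?K"
      using \<kappa>' by (auto simp: \<kappa>_def)
    have sol: "selection_solution p lam theta W \<kappa> x"
      using \<kappa>' by (auto simp: \<kappa>_def selection_solution_def)
    then have "selection_solution p lam theta W \<kappa> (SOME x. selection_solution p lam theta W \<kappa> x)"
      by (rule someI[of "selection_solution p lam theta W \<kappa>" x])
    then have "g \<kappa> = x 1"
      unfolding g_def using \<kappa> sol W by (intro selection_solution_unique[OF ifs, of W \<kappa>]) auto
    also have "x 1 = e"
      using us x[of 1] lex_maximiser_unique by (metis mult.right_neutral)
    finally show "e \<in> g ` ?K"
      using \<kappa> by blast
  qed
  moreover have fin: "finite ?K"
    using W by (intro finite_PiE) auto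
  ultimately show "finite (Ext F)"
    using finite_surj by blast
  have "card (Ext F) \<le> card ?K"
    using \<open>Ext F \<subseteq> g ` ?K\<close> fin by (rule surj_card_le[rotated])
  also have "\<dots> = n ^ card W"
    using W by (simp add: card_funcsetE)
  finally show "card (Ext F) \<le> n ^ card W" .
qed

section \<open>Values of addresses\<close>

lemma common_denominator:
  assumes "finite A" "A \<subseteq> (\<rat> :: real set)"
  obtains N :: nat where "N > 0" "\<And>q. q \<in> A \<Longrightarrow> of_nat N * q \<in> \<int>"
proof -
  have "\<exists>N::nat>0. \<forall>q\<in>A. of_nat N * q \<in> \<int>"
    using assms
  proof (induction rule: finite_induct)
    case empty
    show ?case by auto
  next
    case (insert q A)
    then obtain N :: nat where N: "N > 0" "\<forall>q\<in>A. of_nat N * q \<in> \<int>"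
      by auto
    obtain i :: int and b :: nat where q: "q = of_int i / of_nat b" "b \<noteq> 0"
      using insert.prems by (auto simp: Rats_eq_int_div_nat)
    have "of_nat (b * N) * q = of_int (int N * i)"
      using q by simp
    then have "of_nat (b * N) * q \<in> \<int>"
      by (metis Ints_of_int)
    moreover have "of_nat (b * N) * r \<in> \<int>" if "r \<in> A" for r
    proof -
      have "of_nat b * (of_nat N * r) \<in> \<int>"
        using N(2) that by (blast intro: Ints_mult Ints_of_nat)
      then show ?thesis by (simp add: mult.assoc)
    qed
    ultimately show ?case
      using N q by (intro exI[of _ "b * N"]) auto
  qed
  with that show ?thesis by blast
qed

text \<open>
  With \<open>N\<close> a common denominator of the \<open>\<theta>\<^sub>k / (2\<pi>)\<close>, every value of an address is one of the \<open>N\<close>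
  angles \<open>2\<pi>j/N\<close>, \<open>0 \<le> j < N\<close>.
\<close>

lemma finite_address_values:
  assumes "\<And>k. k \<in> {1..n} \<Longrightarrow> theta k / (2 * pi) \<in> \<rat>"
  shows "finite (address_value theta ` finite_addresses n)"
proof -
  obtain N :: nat where N: "N > 0"
      "\<And>q. q \<in> (\<lambda>k. theta k / (2 * pi)) ` {1..n} \<Longrightarrow> of_nat N * q \<in> \<int>"
    using common_denominator[of "(\<lambda>k. theta k / (2 * pi)) ` {1..n}"] assms by blast
  have "address_value theta a \<in> (\<lambda>j::int. 2 * pi * of_int j / of_nat N) ` {0..<int N}"
    if "a \<in> finite_addresses n" for a
  proof -
    define S where "S = (\<Sum>k\<leftarrow>a. theta k)"
    define v where "v = address_value theta a"
    have "set a \<subseteq> {1..n}"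
      using that by (auto simp: finite_addresses_def)
    then have "of_nat N * (S / (2 * pi)) \<in> \<int>"
      unfolding S_def
    proof (induction a)
      case (Cons k a)
      have "of_nat N * (theta k / (2 * pi)) \<in> \<int>"
        using Cons.prems by (intro N(2) imageI) simp
      moreover have "of_nat N * ((\<Sum>k\<leftarrow>a. theta k) / (2 * pi)) \<in> \<int>"
        using Cons by simp
      ultimately have "of_nat N * (theta k / (2 * pi)) + of_nat N * ((\<Sum>k\<leftarrow>a. theta k) / (2 * pi)) \<in> \<int>"
        by (rule Ints_add)
      then show ?case
        by (simp add: add_divide_distrib distrib_left)
    qed simp
    moreover have "v = S - 2 * pi * of_int \<lfloor>S / (2 * pi)\<rfloor>"
      by (simp add: v_def S_def address_value_def rmod_def)
    then have "v / (2 * pi) = S / (2 * pi) - of_int \<lfloor>S / (2 * pi)\<rfloor>"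
      by (simp add: diff_divide_distrib)
    then have "of_nat N * (v / (2 * pi))
        = of_nat N * (S / (2 * pi)) - of_int (int N * \<lfloor>S / (2 * pi)\<rfloor>)"
      by (simp only: right_diff_distrib) simp
    ultimately have "of_nat N * (v / (2 * pi)) \<in> \<int>"
      by (metis Ints_diff Ints_of_int)
    then obtain j where j: "of_nat N * (v / (2 * pi)) = of_int j"
      by (auto elim: Ints_cases)
    then have vj: "v = 2 * pi * of_int j / of_nat N"
      using N(1) by (simp add: field_simps)
    have "0 \<le> v" "v < 2 * pi"
      unfolding v_def address_value_def by (simp_all add: rmod_nonneg rmod_less)
    then have "0 \<le> v / (2 * pi)" "v / (2 * pi) < 1"
      by (simp_all add: field_simps)
    then have "0 \<le> of_nat N * (v / (2 * pi))"
      by (intro mult_nonneg_nonneg of_nat_0_le_iff)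
    moreover have "of_nat N * (v / (2 * pi)) < of_nat N * 1"
      using N(1) \<open>v / (2 * pi) < 1\<close> by (intro mult_strict_left_mono) simp_all
    ultimately have "0 \<le> j" "j < int N"
      unfolding j by simp_all
    with vj show ?thesis
      by (auto simp: v_def)
  qed
  then show ?thesis
    by (meson finite_atLeastLessThan_int finite_imageI finite_subset image_subsetI)
qed

lemma cis_address_value: "cis (- address_value theta a) = cis (- (\<Sum>k\<leftarrow>a. theta k))"
proof -
  have "- address_value theta a
      = - (\<Sum>k\<leftarrow>a. theta k) + 2 * pi * of_int \<lfloor>(\<Sum>k\<leftarrow>a. theta k) / (2 * pi)\<rfloor>"
    by (simp add: address_value_def rmod_def)
  then show ?thesis
    by (simp only: cis_mult[symmetric]) simp
qed

theorem theorem2p8: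
  fixes n :: nat and p :: "nat \<Rightarrow> complex" and lam theta :: "nat \<Rightarrow> real" and F :: "complex set"
  assumes "planar_ifs n lam theta"
    and "fractal_of_unity n p lam theta F"
  shows "finite (Ext F) \<and>
    card (Ext F) \<le> n ^ (2 * card (address_value theta ` finite_addresses n))"
proof -
  let ?V = "address_value theta ` finite_addresses n"
  define W where "W = (\<lambda>v. cis (- v)) ` ?V"
  have F: "ifs_fractal n p lam theta F"
    using assms by (simp add: fractal_of_unity_def)
  have finV: "finite ?V"
    using assms by (intro finite_address_values) (auto simp: fractal_of_unity_def)
  have W: "W = (\<lambda>a. cis (- (\<Sum>k\<leftarrow>a. theta k))) ` finite_addresses n"
    by (simp add: W_def image_image cis_address_value)
  have finW: "finite W"
    using finV by (simp add: W_def)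
  have oneW: "1 \<in> W"
    unfolding W by (intro image_eqI[of _ _ "[]"]) (auto simp: finite_addresses_def)
  have zeroW: "0 \<notin> W"
    by (auto simp: W)
  \<comment> \<open>turning back by \<open>\<theta>\<^sub>k\<close> corresponds to prepending the letter \<open>k\<close> to the address\<close>
  have closedW: "w * cis (- theta k) \<in> W" if w: "w \<in> W" and k: "k \<in> {1..n}" for w k
  proof -
    obtain a where a: "a \<in> finite_addresses n" "w = cis (- (\<Sum>k\<leftarrow>a. theta k))"
      using w unfolding W by blast
    then have "w * cis (- theta k) = cis (- (\<Sum>k\<leftarrow>k # a. theta k))"
      by (simp add: cis_mult algebra_simps)
    moreover have "k # a \<in> finite_addresses n"
      using a k by (simp add: finite_addresses_def)
    ultimately show ?thesis
      unfolding W by blast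
  qed
  note bound = card_Ext_le_card_selections[OF assms(1) F finW oneW zeroW closedW]
  have "card W \<le> 2 * card ?V"
    unfolding W_def using card_image_le[OF finV, of "\<lambda>v. cis (- v)"] by simp
  then have "n ^ card W \<le> n ^ (2 * card ?V)"
    using assms(1) by (intro power_increasing) (auto simp: planar_ifs_def)
  with bound show ?thesis by simp
qed

end
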